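(* For every integer $k\ge 5$, the path $P_4$ on $4$ vertices is $k$-Tur\'an-good.
   Context: All graphs are finite and simple. $P_r$ is the path on $r$ vertices (with $r-1$ edges) and $K_r$ is the complete graph on $r$ vertices. $\mathcal{N}(H,G)$ denotes the number of copies of $H$ in $G$, i.e. the number of (not necessarily induced) subgraphs of $G$ isomorphic to $H$. A graph is $F$-free if it contains no copy of $F$ as a (not necessarily induced) subgraph. $ex(n,H,F)=\max\{\mathcal{N}(H,G): G \text{ is an } n\text{-vertex } F\text{-free graph}\}$. The Tur\'an graph $T_{k-1}(n)$ is the complete $(k-1)$-partite graph on $n$ vertices in which each class has size $\lceil n/(k-1)\rceil$ or $\lfloor n/(k-1)\rfloor$. A graph $H$ that does not contain $K_k$ as a subgraph is called $k$-Tur\'an-good if $ex(n,H,K_k)=\mathcal{N}(H,T_{k-1}(n))$ for every sufficiently large $n$. *)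

theory Defs
  imports Complex_Main
begin

text \<open>A graph is a pair of a vertex set and a set of edges, an edge being a two-element set of
  vertices.\<close>

type_synonym 'a graph = "'a set \<times> 'a set set"

abbreviation verts :: "'a graph \<Rightarrow> 'a set" where "verts \<equiv> fst"
abbreviation edges :: "'a graph \<Rightarrow> 'a set set" where "edges \<equiv> snd"

definition simple_graph :: "'a graph \<Rightarrow> bool" where
  "simple_graph G \<longleftrightarrow> finite (verts G) \<and> (\<forall>e\<in>edges G. e \<subseteq> verts G \<and> card e = 2)"

definition subgraph :: "'a graph \<Rightarrow> 'a graph \<Rightarrow> bool" where
  "subgraph S G \<longleftrightarrow> simple_graph S \<and> verts S \<subseteq> verts G \<and> edges S \<subseteq> edges G"

definition graph_iso :: "'a graph \<Rightarrow> 'b graph \<Rightarrow> bool" where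
  "graph_iso G H \<longleftrightarrow> (\<exists>f. bij_betw f (verts G) (verts H) \<and>
     (\<forall>u\<in>verts G. \<forall>v\<in>verts G. {u, v} \<in> edges G \<longleftrightarrow> {f u, f v} \<in> edges H))"

definition copies :: "'b graph \<Rightarrow> 'a graph \<Rightarrow> 'a graph set" where
  "copies H G = {S. subgraph S G \<and> graph_iso H S}"

definition num_copies :: "'b graph \<Rightarrow> 'a graph \<Rightarrow> nat" where
  "num_copies H G = card (copies H G)"

definition graph_free :: "'b graph \<Rightarrow> 'a graph \<Rightarrow> bool" where
  "graph_free F G \<longleftrightarrow> copies F G = {}"

text \<open>Vertices are taken to be natural numbers, which loses nothing: every finite graph is
  isomorphic to one on natural numbers. The maximum is over a finite set, see
  \<open>finite_num_copies\<close> below, which is nonempty if \<open>F\<close> has an edge.\<close>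

definition gen_turan_number :: "nat \<Rightarrow> 'b graph \<Rightarrow> 'c graph \<Rightarrow> nat" where
  "gen_turan_number n H F =
     Max {num_copies H G |G :: nat graph. simple_graph G \<and> card (verts G) = n \<and> graph_free F G}"

definition path_graph :: "nat \<Rightarrow> nat graph" where
  "path_graph r = ({..<r}, {{i, Suc i} |i. Suc i < r})"

definition complete_graph :: "nat \<Rightarrow> nat graph" where
  "complete_graph r = ({..<r}, {e. e \<subseteq> {..<r} \<and> card e = 2})"

text \<open>The \<open>r\<close> classes are the residue classes modulo \<open>r\<close>; their sizes are as required by
  \<open>turan_graph_class_size\<close> below.\<close>

definition turan_graph :: "nat \<Rightarrow> nat \<Rightarrow> nat graph" where
  "turan_graph r n = ({..<n}, {{u, v} |u v. u < n \<and> v < n \<and> u mod r \<noteq> v mod r})"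

definition turan_good :: "nat \<Rightarrow> 'b graph \<Rightarrow> bool" where
  "turan_good k H \<longleftrightarrow> simple_graph H \<and> graph_free (complete_graph k) H \<and>
     (\<exists>N. \<forall>n\<ge>N. gen_turan_number n H (complete_graph k) = num_copies H (turan_graph (k - 1) n))"

lemma turan_graph_class_size:
  assumes "j < r"
  shows "card {v \<in> verts (turan_graph r n). v mod r = j} \<in>
           {nat \<lfloor>real n / real r\<rfloor>, nat \<lceil>real n / real r\<rceil>}"
proof -
  have r: "r > 0" using assms by simp
  define q m where "q = n div r" and "m = n mod r"
  have n: "n = q * r + m" and m: "m < r" using r by (simp_all add: q_def m_def)
  have "{v \<in> verts (turan_graph r n). v mod r = j} =
          (\<lambda>i. i * r + j) ` {..<(if j < m then Suc q else q)}" (is "?L = ?f ` ?I")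
  proof (intro equalityI subsetI)
    fix v assume "v \<in> ?L"
    then have v: "v < n" "v mod r = j" by (auto simp: turan_graph_def)
    have eq: "v = ?f (v div r)" using v(2) div_mult_mod_eq[of v r] by simp
    have "v div r \<le> q" using v(1) unfolding q_def by (simp add: div_le_mono)
    moreover have "j < m" if "v div r = q" using eq v(1) n that by simp
    ultimately have "v div r \<in> ?I" by (auto simp: less_Suc_eq_le order.order_iff_strict)
    with eq show "v \<in> ?f ` ?I" by blast
  next
    fix v assume "v \<in> ?f ` ?I"
    then obtain i where i: "i \<in> ?I" "v = i * r + j" by auto
    have "v < n"
    proof (cases "i < q")
      case True
      then have "Suc i * r \<le> q * r" by (intro mult_right_mono) auto
      then show ?thesis using i(2) n assms by simp
    next
      case False
      then have "i = q" "j < m" using i(1) by (auto split: if_splits)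
      then show ?thesis using i(2) n by simp
    qed
    then show "v \<in> ?L" using i(2) assms by (simp add: turan_graph_def)
  qed
  moreover have "inj_on ?f ?I" using r by (auto simp: inj_on_def)
  ultimately have c: "card ?L = (if j < m then Suc q else q)" by (simp add: card_image)
  have fl: "\<lfloor>real n / real r\<rfloor> = int q" by (simp add: q_def floor_divide_of_nat_eq)
  show ?thesis
  proof (cases "j < m")
    case True
    have "real n / real r = real q + real m / real r" using n r by (simp add: field_simps)
    then have "\<lceil>real n / real r\<rceil> = int (Suc q)" using True m r
      by (intro ceiling_unique) (auto simp: field_simps)
    then have "nat \<lceil>real n / real r\<rceil> = Suc q" by simp
    then show ?thesis using c True by simp
  qed (use c fl in simp)
qed

lemma finite_num_copies:
  "finite {num_copies H G |G :: nat graph. simple_graph G \<and> card (verts G) = n \<and> graph_free F G}"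
proof (rule finite_subset)
  have "num_copies H G \<le> 2 ^ n * 2 ^ (2 ^ n)" if G: "simple_graph G" "card (verts G) = n"
    for G :: "nat graph"
  proof -
    have fin: "finite (verts G)" using G by (simp add: simple_graph_def)
    have "copies H G \<subseteq> Pow (verts G) \<times> Pow (Pow (verts G))"
      by (fastforce simp: copies_def subgraph_def simple_graph_def)
    then have "card (copies H G) \<le> card (Pow (verts G) \<times> Pow (Pow (verts G)))"
      using fin by (intro card_mono) auto
    then show ?thesis using fin G by (simp add: num_copies_def card_cartesian_product card_Pow)
  qed
  then show "{num_copies H G |G :: nat graph. simple_graph G \<and> card (verts G) = n \<and> graph_free F G}
      \<subseteq> {..2 ^ n * 2 ^ (2 ^ n)}" by auto
qed simp

end

theory Submission
  imports Defs "HOL-Combinatorics.Multiset_Permutations"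
begin

text \<open>On four vertices, the number of Hamiltonian paths is at most twice the number of perfect
  matchings, plus twice the indicator of \<open>K\<^sub>4\<close>, plus the number of triangles, with equality if the induced
  graph is complete multipartite. Summing over all 4-sets gives
  \<open>N(P\<^sub>4) \<le> 2 N(2K\<^sub>2) + 2 N(K\<^sub>4) + (n - 3) N(K\<^sub>3)\<close>, with equality for the Turan graph, and each of the three terms
  is separately maximised by the Turan graph among graphs without an \<open>(r + 1)\<close>-clique, \<open>r = k - 1\<close>.

  For complete graphs \<open>K\<^sub>s\<close> this is Zykov's theorem, by induction on the number of vertices: delete an
  \<open>r\<close>-clique \<open>K\<close>, and observe that an \<open>l\<close>-clique outside \<open>K\<close> has at most \<open>r - l\<close> common neighbours in \<open>K\<close>,
  with equality in the Turan graph. For \<open>2K\<^sub>2\<close>, the count depends only on the degree sequence; it is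
  largest when the number of edges is largest and the degrees are as equal as possible.\<close>

section \<open>Cliques in Turan graphs\<close>

text \<open>Edge set and vertex set are separate arguments, so that deleting vertices shrinks
  \<open>V\<close> and leaves \<open>E\<close> alone.\<close>

definition cliques :: "'a set set \<Rightarrow> 'a set \<Rightarrow> nat \<Rightarrow> 'a set set" where
  "cliques E V s = {C. C \<subseteq> V \<and> finite C \<and> card C = s \<and> (\<forall>u\<in>C. \<forall>v\<in>C. u \<noteq> v \<longrightarrow> {u, v} \<in> E)}"

lemma cliquesI:
  "C \<subseteq> V \<Longrightarrow> finite C \<Longrightarrow> card C = s \<Longrightarrow> (\<And>u v. u \<in> C \<Longrightarrow> v \<in> C \<Longrightarrow> u \<noteq> v \<Longrightarrow> {u, v} \<in> E)
    \<Longrightarrow> C \<in> cliques E V s"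
  by (auto simp: cliques_def)

lemma cliquesD:
  assumes "C \<in> cliques E V s"
  shows "C \<subseteq> V" "finite C" "card C = s" "\<And>u v. u \<in> C \<Longrightarrow> v \<in> C \<Longrightarrow> u \<noteq> v \<Longrightarrow> {u, v} \<in> E"
  using assms by (auto simp: cliques_def)

lemma finite_cliques [simp]: "finite V \<Longrightarrow> finite (cliques E V s)"
  by (rule finite_subset[of _ "Pow V"]) (auto simp: cliques_def)

lemma cliques_mono: "E \<subseteq> E' \<Longrightarrow> cliques E V s \<subseteq> cliques E' V s"
  by (fastforce simp: cliques_def)

lemma cliques_empty_mono:
  assumes "cliques E V s = {}" "s \<le> t"
  shows "cliques E V t = {}"
proof (rule ccontr)
  assume "cliques E V t \<noteq> {}"
  then obtain C where C: "C \<in> cliques E V t" by blast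
  then obtain D where D: "D \<subseteq> C" "card D = s" "finite D"
    using assms(2) cliquesD[OF C] by (metis obtain_subset_with_card_n)
  then have "D \<in> cliques E V s" using cliquesD[OF C] by (intro cliquesI) (blast | simp)+
  with assms(1) show False by blast
qed

text \<open>Every clique is the union of its part \<open>L\<close> outside \<open>K\<close> and a set of common neighbours of \<open>L\<close>
  in the clique \<open>K\<close>.\<close>

lemma card_cliques_split:
  assumes fin: "finite V" and K: "K \<in> cliques E V r"
  shows "card (cliques E V s) =
    (\<Sum>l\<le>s. \<Sum>L\<in>cliques E (V - K) l. card {v \<in> K. \<forall>u\<in>L. {u, v} \<in> E} choose (s - l))"
proof -
  define N where "N L = {v \<in> K. \<forall>u\<in>L. {u, v} \<in> E}" for L
  define A where "A = (\<Union>l\<le>s. cliques E (V - K) l)"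
  define S where "S = (SIGMA L:A. {J. J \<subseteq> N L \<and> card J = s - card L})"
  note KD = cliquesD[OF K]
  have finN: "finite (N L)" for L using KD by (simp add: N_def)
  have finA: "finite A" using fin by (simp add: A_def)
  have "bij_betw (\<lambda>(L, J). L \<union> J) S (cliques E V s)"
  proof (rule bij_betw_byWitness[where f' = "\<lambda>C. (C - K, C \<inter> K)"])
    show "\<forall>p\<in>S. (\<lambda>C. (C - K, C \<inter> K)) ((\<lambda>(L, J). L \<union> J) p) = p"
      by (auto simp: S_def A_def N_def cliques_def)
    show "\<forall>C\<in>cliques E V s. (\<lambda>(L, J). L \<union> J) (C - K, C \<inter> K) = C" by auto
    show "(\<lambda>(L, J). L \<union> J) ` S \<subseteq> cliques E V s"
    proof
      fix C assume "C \<in> (\<lambda>(L, J). L \<union> J) ` S"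
      then obtain L J l where C: "C = L \<union> J" "l \<le> s" "L \<in> cliques E (V - K) l"
        "J \<subseteq> N L" "card J = s - card L" by (auto simp: S_def A_def)
      note LD = cliquesD[OF C(3)]
      have fJ: "finite J" using C(4) finN finite_subset by blast
      have "L \<inter> J = {}" using LD C(4) by (auto simp: N_def)
      then have "card C = s" using C fJ LD by (simp add: card_Un_disjoint)
      moreover have "{u, v} \<in> E" if "u \<in> C" "v \<in> C" "u \<noteq> v" for u v
      proof -
        have J: "w \<in> K \<and> (\<forall>z\<in>L. {z, w} \<in> E \<and> {w, z} \<in> E)" if "w \<in> J" for w
          using that C(4) by (auto simp: N_def insert_commute)
        show ?thesis using that C(1) LD(4) KD(4) J by blast
      qed
      ultimately show "C \<in> cliques E V s"
        using C fJ LD KD by (intro cliquesI) (auto simp: N_def)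
    qed
    show "(\<lambda>C. (C - K, C \<inter> K)) ` cliques E V s \<subseteq> S"
    proof
      fix p assume "p \<in> (\<lambda>C. (C - K, C \<inter> K)) ` cliques E V s"
      then obtain C where C: "C \<in> cliques E V s" and p: "p = (C - K, C \<inter> K)" by blast
      note CD = cliquesD[OF C]
      have c: "card (C - K) + card (C \<inter> K) = s"
        using CD card_Un_disjoint[of "C - K" "C \<inter> K"]
        by (metis Diff_disjoint Int_commute Un_Diff_Int finite_Diff finite_Int inf_assoc inf_bot_right)
      have "C - K \<in> cliques E (V - K) (card (C - K))"
        using CD by (intro cliquesI) auto
      then have "C - K \<in> A" using c unfolding A_def by auto
      moreover have "C \<inter> K \<subseteq> N (C - K)" using CD by (auto simp: N_def)
      ultimately show "p \<in> S" using p c by (auto simp: S_def)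
    qed
  qed
  then have "card (cliques E V s) = card S" by (simp add: bij_betw_same_card)
  also have "\<dots> = (\<Sum>L\<in>A. card {J. J \<subseteq> N L \<and> card J = s - card L})"
    unfolding S_def using finA finN by (intro card_SigmaI) auto
  also have "\<dots> = (\<Sum>L\<in>A. card (N L) choose (s - card L))"
    using finN by (simp add: n_subsets)
  also have "\<dots> = (\<Sum>l\<le>s. \<Sum>L\<in>cliques E (V - K) l. card (N L) choose (s - card L))"
    unfolding A_def using fin by (intro sum.UNION_disjoint) (auto simp: cliques_def)
  also have "\<dots> = (\<Sum>l\<le>s. \<Sum>L\<in>cliques E (V - K) l. card (N L) choose (s - l))"
    by (intro sum.cong refl) (simp add: cliquesD(3))
  finally show ?thesis by (simp add: N_def)
qed

text \<open>A graph without an \<open>r\<close>-clique can receive any missing edge without creating an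
  \<open>(r + 1)\<close>-clique.\<close>

lemma extend_to_clique:
  assumes "finite V" "r \<le> card V" "cliques E V (Suc r) = {}"
  obtains E' where "E \<subseteq> E'" "cliques E' V (Suc r) = {}" "cliques E' V r \<noteq> {}"
proof -
  have "\<exists>E'. E \<subseteq> E' \<and> cliques E' V (Suc r) = {} \<and> cliques E' V r \<noteq> {}"
    using assms(3)
  \<comment> \<open>The measure is finite because \<open>V\<close> is; \<open>E\<close> itself may
    be infinite.\<close>
  proof (induction "card (Pow V - E)" arbitrary: E rule: less_induct)
    case less
    show ?case
    proof (cases "cliques E V r = {}")
      case False
      with less.prems show ?thesis by blast
    next
      case True
      obtain C where C: "C \<subseteq> V" "card C = r" "finite C"
        using assms(2) by (metis obtain_subset_with_card_n)
      then obtain x y where xy: "x \<in> C" "y \<in> C" "x \<noteq> y" "{x, y} \<notin> E"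
        using True by (auto simp: cliques_def)
      let ?E = "insert {x, y} E"
      \<comment> \<open>A clique that is new in \<open>?E\<close> uses the pair
        \<open>{x, y}\<close>. Removing \<open>x\<close> from it leaves an \<open>r\<close>-clique
        of \<open>E\<close>, and none exists.\<close>
      have "cliques ?E V (Suc r) = {}"
      proof (rule ccontr)
        assume "cliques ?E V (Suc r) \<noteq> {}"
        then obtain D where D: "D \<in> cliques ?E V (Suc r)" by blast
        note DD = cliquesD[OF D]
        have "x \<in> D"
        proof (rule ccontr)
          assume "x \<notin> D"
          then have "D \<in> cliques E V (Suc r)"
            using DD by (intro cliquesI) (auto simp: doubleton_eq_iff)
          with less.prems show False by blast
        qed
        then have "D - {x} \<in> cliques E V r"
          using DD by (intro cliquesI) (auto simp: doubleton_eq_iff)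
        with True show False by blast
      qed
      moreover have "card (Pow V - ?E) < card (Pow V - E)"
        using assms(1) xy C(1) by (intro psubset_card_mono) auto
      ultimately obtain E' where "?E \<subseteq> E'" "cliques E' V (Suc r) = {}" "cliques E' V r \<noteq> {}"
        using less.hyps[of ?E] by metis
      then show ?thesis by (intro exI[of _ E']) simp
    qed
  qed
  with that show thesis by blast
qed

section \<open>Clique counts of the Turan graph and Zykov's theorem\<close>

lemma edges_turan_graph_iff:
  "{u, v} \<in> edges (turan_graph r n) \<longleftrightarrow> u < n \<and> v < n \<and> u mod r \<noteq> v mod r"
  by (auto simp: turan_graph_def doubleton_eq_iff)

lemma cliques_turan_graph:
  "C \<in> cliques (edges (turan_graph r n)) {..<n} s \<longleftrightarrow>
    C \<subseteq> {..<n} \<and> card C = s \<and> inj_on (\<lambda>v. v mod r) C"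
  by (auto simp: cliques_def edges_turan_graph_iff inj_on_def intro: finite_subset)

text \<open>Pigeonhole: the vertices of a clique have pairwise different residues, and there are
  only \<open>r\<close> residues.\<close>

lemma turan_graph_clique_free:
  assumes "r > 0"
  shows "cliques (edges (turan_graph r n)) {..<n} (Suc r) = {}"
proof (rule ccontr)
  assume "\<not> ?thesis"
  then obtain C where C: "card C = Suc r" "inj_on (\<lambda>v. v mod r) C"
    by (auto simp: cliques_turan_graph)
  have "card ((\<lambda>v. v mod r) ` C) \<le> card {..<r}" using assms by (intro card_mono) auto
  with C show False by (simp add: card_image)
qed

text \<open>Split along a clique \<open>K\<close> that meets every residue class once. An
  \<open>l\<close>-clique outside \<open>K\<close> blocks exactly \<open>l\<close> residues, so it
  has exactly \<open>r - l\<close> common neighbours in \<open>K\<close>.\<close>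

lemma card_cliques_turan_rec:
  assumes "r \<le> n" "r > 0"
  shows "card (cliques (edges (turan_graph r n)) {..<n} s) =
    (\<Sum>l\<le>s. card (cliques (edges (turan_graph r (n - r))) {..<n - r} l) * ((r - l) choose (s - l)))"
proof -
  let ?E = "edges (turan_graph r n)"
  \<comment> \<open>Taking the last \<open>r\<close> vertices makes the remainder literally the
    Turan graph on \<open>{..<n - r}\<close>.\<close>
  define K where "K = {n - r..<n}"
  have inj: "inj_on (\<lambda>v. v mod r) K"
  proof (rule inj_onI)
    fix u v assume uv: "u \<in> K" "v \<in> K" "u mod r = v mod r"
    have "u = v" if "u \<le> v" "u \<in> K" "v \<in> K" "u mod r = v mod r" for u v
    proof -
      have "r dvd v - u" using that by (metis mod_eq_dvd_iff_nat)
      moreover have "v - u < r" using that assms by (auto simp: K_def)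
      ultimately show ?thesis using that(1) by (meson dvd_imp_le leD diff_is_0_eq le_antisym not_gr_zero)
    qed
    then show "u = v" using uv by (metis nle_le)
  qed
  have K: "K \<in> cliques ?E {..<n} r"
    using inj assms by (auto simp: cliques_turan_graph K_def)
  have surj: "(\<lambda>v. v mod r) ` K = {..<r}"
    using inj assms K by (intro card_subset_eq) (auto simp: card_image cliques_turan_graph)
  have VK: "{..<n} - K = {..<n - r}" by (auto simp: K_def)
  have eq: "cliques ?E {..<n - r} l = cliques (edges (turan_graph r (n - r))) {..<n - r} l" for l
    by (fastforce simp: cliques_def edges_turan_graph_iff)
  have N: "card {v \<in> K. \<forall>u\<in>L. {u, v} \<in> ?E} = r - l"
    if "L \<in> cliques (edges (turan_graph r (n - r))) {..<n - r} l" for L l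
  proof -
    have L: "L \<subseteq> {..<n - r}" "card L = l" "inj_on (\<lambda>v. v mod r) L"
      using that by (auto simp: cliques_turan_graph)
    define N where "N = {v \<in> K. \<forall>u\<in>L. {u, v} \<in> ?E}"
    have "N = {v \<in> K. v mod r \<notin> (\<lambda>u. u mod r) ` L}"
    proof -
      have "u < n" if "u \<in> L" for u using L(1) that by auto
      then show ?thesis by (auto simp: N_def K_def edges_turan_graph_iff image_iff)
    qed
    then have "(\<lambda>v. v mod r) ` N = (\<lambda>v. v mod r) ` K - (\<lambda>u. u mod r) ` L"
      by auto
    then have "(\<lambda>v. v mod r) ` N = {..<r} - (\<lambda>u. u mod r) ` L"
      using surj by simp
    moreover have "card ({..<r} - (\<lambda>u. u mod r) ` L) = r - l"
    proof -
      have "finite L" using L(1) finite_subset by blast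
      then show ?thesis using L(2,3) assms(2) by (subst card_Diff_subset) (auto simp: card_image)
    qed
    moreover have "inj_on (\<lambda>v. v mod r) N" using inj by (auto simp: N_def intro: inj_on_subset)
    ultimately show ?thesis unfolding N_def[symmetric] by (metis card_image)
  qed
  show ?thesis
    unfolding card_cliques_split[OF finite_lessThan K] VK eq
    by (intro sum.cong refl) (simp add: N)
qed

text \<open>The split along an \<open>r\<close>-clique gives an upper bound with the same binomial
  coefficients as the Turan recursion. All clique sizes \<open>l \<le> s\<close> enter it, hence
  \<open>s\<close> is arbitrary in the induction.\<close>

lemma card_cliques_le_turan:
  assumes "r > 0" "finite V" "cliques E V (Suc r) = {}"
  shows "card (cliques E V s) \<le> card (cliques (edges (turan_graph r (card V))) {..<card V} s)"
  using assms(2,3)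
proof (induction "card V" arbitrary: V E s rule: less_induct)
  case less
  show ?case
  proof (cases "card V < r")
    case True
    \<comment> \<open>With fewer than \<open>r\<close> vertices all residues differ, so the Turan
      graph is complete.\<close>
    have "cliques (edges (turan_graph r (card V))) {..<card V} s = {C. C \<subseteq> {..<card V} \<and> card C = s}"
      using True by (auto simp: cliques_turan_graph inj_on_def subset_iff) (metis mod_less order.strict_trans)
    then have "card (cliques (edges (turan_graph r (card V))) {..<card V} s) = card V choose s"
      by (simp add: n_subsets)
    moreover have "card (cliques E V s) \<le> card {C. C \<subseteq> V \<and> card C = s}"
      using less.prems(1) by (intro card_mono) (auto simp: cliques_def)
    ultimately show ?thesis using less.prems(1) by (simp add: n_subsets)
  next
    case False
    \<comment> \<open>Adding edges can only increase the clique counts, so it suffices to bound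
      those of \<open>E'\<close>, which has an \<open>r\<close>-clique to delete.\<close>
    then obtain E' K where E': "E \<subseteq> E'" "cliques E' V (Suc r) = {}" and K: "K \<in> cliques E' V r"
      using extend_to_clique[of V r E] less.prems by (metis all_not_in_conv not_less)
    note KD = cliquesD[OF K]
    let ?T = "\<lambda>n l. card (cliques (edges (turan_graph r n)) {..<n} l)"
    have cVK: "card (V - K) = card V - r" using KD by (simp add: card_Diff_subset)
    have free: "cliques E' (V - K) (Suc r) = {}" using E'(2) by (auto simp: cliques_def)
    have IH: "card (cliques E' (V - K) l) \<le> ?T (card V - r) l" for l
      using less.hyps[of "V - K" E' l] free less.prems(1) cVK False assms(1) by auto
    \<comment> \<open>\<open>L\<close> and its common neighbours in \<open>K\<close> form a clique, which has at most \<open>r\<close> vertices.\<close>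
    have N: "card {v \<in> K. \<forall>u\<in>L. {u, v} \<in> E'} \<le> r - l" if L: "L \<in> cliques E' (V - K) l" for L l
    proof -
      note LD = cliquesD[OF L]
      define N where "N = {v \<in> K. \<forall>u\<in>L. {u, v} \<in> E'}"
      have fN: "finite N" using KD by (simp add: N_def)
      have "L \<inter> N = {}" using LD by (auto simp: N_def)
      then have card_LN: "card (L \<union> N) = l + card N" using fN LD by (simp add: card_Un_disjoint)
      have adj: "{u, v} \<in> E'" if "u \<in> L \<union> N" "v \<in> L \<union> N" "u \<noteq> v" for u v
      proof -
        have "w \<in> K \<and> (\<forall>z\<in>L. {z, w} \<in> E' \<and> {w, z} \<in> E')" if "w \<in> N" for w
          using that by (auto simp: N_def insert_commute)
        then show ?thesis using that LD(4) KD(4) by blast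
      qed
      have "L \<union> N \<subseteq> V" using LD(1) KD(1) by (auto simp: N_def)
      then have "L \<union> N \<in> cliques E' V (l + card N)"
        using fN LD(2) by (intro cliquesI card_LN adj) simp_all
      then have "\<not> Suc r \<le> l + card N" using cliques_empty_mono[OF E'(2)] by blast
      then show ?thesis by (simp add: N_def)
    qed
    have "card (cliques E V s) \<le> card (cliques E' V s)"
      using less.prems(1) E'(1) by (intro card_mono finite_cliques cliques_mono)
    also have "\<dots> \<le> (\<Sum>l\<le>s. \<Sum>L\<in>cliques E' (V - K) l. (r - l) choose (s - l))"
      unfolding card_cliques_split[OF less.prems(1) K]
      by (rule sum_mono, rule sum_mono, rule binomial_right_mono, rule N)
    also have "\<dots> \<le> (\<Sum>l\<le>s. ?T (card V - r) l * ((r - l) choose (s - l)))"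
      by (simp add: IH sum_mono)
    also have "\<dots> = ?T (card V) s" using card_cliques_turan_rec False assms(1) by simp
    finally show ?thesis .
  qed
qed

section \<open>Sums over ordered quadruples of vertices\<close>

text \<open>Integer-valued because later expansions subtract. For \<open>a = b\<close> it tests a
  singleton, which is never an edge of a simple graph.\<close>

definition adj :: "'a set set \<Rightarrow> 'a \<Rightarrow> 'a \<Rightarrow> int" where
  "adj E a b = of_bool ({a, b} \<in> E)"

lemma adj_commute: "adj E a b = adj E b a"
  by (simp add: adj_def insert_commute)

definition quads :: "'a set \<Rightarrow> ('a \<times> 'a \<times> 'a \<times> 'a) set" where
  "quads V = {(a, b, c, d). {a, b, c, d} \<subseteq> V \<and> distinct [a, b, c, d]}"

lemma quads_subset: "quads V \<subseteq> V \<times> V \<times> V \<times> V"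
  by (auto simp: quads_def)

lemma finite_quads [simp]: "finite V \<Longrightarrow> finite (quads V)"
  by (rule finite_subset[OF quads_subset]) simp

definition sum_quads :: "'a set \<Rightarrow> ('a \<Rightarrow> 'a \<Rightarrow> 'a \<Rightarrow> 'a \<Rightarrow> int) \<Rightarrow> int" where
  "sum_quads V f = (\<Sum>(a, b, c, d)\<in>quads V. f a b c d)"

text \<open>Permuting coordinates maps \<open>quads V\<close> onto itself. With the identity, these
  orders represent the 24 orderings up to reversal, one for each Hamiltonian path on four
  vertices.\<close>

lemma sum_quads_permute:
  shows "sum_quads V (\<lambda>a b c d. f a b d c) = sum_quads V f"
    and "sum_quads V (\<lambda>a b c d. f a c b d) = sum_quads V f"
    and "sum_quads V (\<lambda>a b c d. f a c d b) = sum_quads V f"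
    and "sum_quads V (\<lambda>a b c d. f a d b c) = sum_quads V f"
    and "sum_quads V (\<lambda>a b c d. f b c d a) = sum_quads V f"
    and "sum_quads V (\<lambda>a b c d. f b a c d) = sum_quads V f"
    and "sum_quads V (\<lambda>a b c d. f b a d c) = sum_quads V f"
    and "sum_quads V (\<lambda>a b c d. f b c a d) = sum_quads V f"
    and "sum_quads V (\<lambda>a b c d. f b d a c) = sum_quads V f"
    and "sum_quads V (\<lambda>a b c d. f c a b d) = sum_quads V f"
    and "sum_quads V (\<lambda>a b c d. f c b a d) = sum_quads V f"
proof -
  have reindex: "sum_quads V g = sum_quads V h"
    if "\<And>t. t \<in> quads V \<Longrightarrow> i (j t) = t \<and> j (i t) = t \<and> i t \<in> quads V \<and> j t \<in> quads V"
      "\<And>a b c d. case_prod (\<lambda>a. case_prod (\<lambda>b. case_prod (h a b))) (j (a, b, c, d)) = g a b c d"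
    for g h :: "'a \<Rightarrow> 'a \<Rightarrow> 'a \<Rightarrow> 'a \<Rightarrow> int" and i j
    unfolding sum_quads_def using that by (intro sum.reindex_bij_witness[of _ i j]) auto
  show "sum_quads V (\<lambda>a b c d. f a b d c) = sum_quads V f"
    by (rule reindex[of "\<lambda>(a, b, c, d). (a, b, d, c)" "\<lambda>(a, b, c, d). (a, b, d, c)"]) (auto simp: quads_def)
  show "sum_quads V (\<lambda>a b c d. f a c b d) = sum_quads V f"
    by (rule reindex[of "\<lambda>(a, b, c, d). (a, c, b, d)" "\<lambda>(a, b, c, d). (a, c, b, d)"]) (auto simp: quads_def)
  show "sum_quads V (\<lambda>a b c d. f a c d b) = sum_quads V f"
    by (rule reindex[of "\<lambda>(a, b, c, d). (a, d, b, c)" "\<lambda>(a, b, c, d). (a, c, d, b)"]) (auto simp: quads_def)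
  show "sum_quads V (\<lambda>a b c d. f a d b c) = sum_quads V f"
    by (rule reindex[of "\<lambda>(a, b, c, d). (a, c, d, b)" "\<lambda>(a, b, c, d). (a, d, b, c)"]) (auto simp: quads_def)
  show "sum_quads V (\<lambda>a b c d. f b c d a) = sum_quads V f"
    by (rule reindex[of "\<lambda>(a, b, c, d). (d, a, b, c)" "\<lambda>(a, b, c, d). (b, c, d, a)"]) (auto simp: quads_def)
  show "sum_quads V (\<lambda>a b c d. f b a c d) = sum_quads V f"
    by (rule reindex[of "\<lambda>(a, b, c, d). (b, a, c, d)" "\<lambda>(a, b, c, d). (b, a, c, d)"]) (auto simp: quads_def)
  show "sum_quads V (\<lambda>a b c d. f b a d c) = sum_quads V f"
    by (rule reindex[of "\<lambda>(a, b, c, d). (b, a, d, c)" "\<lambda>(a, b, c, d). (b, a, d, c)"]) (auto simp: quads_def)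
  show "sum_quads V (\<lambda>a b c d. f b c a d) = sum_quads V f"
    by (rule reindex[of "\<lambda>(a, b, c, d). (c, a, b, d)" "\<lambda>(a, b, c, d). (b, c, a, d)"]) (auto simp: quads_def)
  show "sum_quads V (\<lambda>a b c d. f b d a c) = sum_quads V f"
    by (rule reindex[of "\<lambda>(a, b, c, d). (c, a, d, b)" "\<lambda>(a, b, c, d). (b, d, a, c)"]) (auto simp: quads_def)
  show "sum_quads V (\<lambda>a b c d. f c a b d) = sum_quads V f"
    by (rule reindex[of "\<lambda>(a, b, c, d). (b, c, a, d)" "\<lambda>(a, b, c, d). (c, a, b, d)"]) (auto simp: quads_def)
  show "sum_quads V (\<lambda>a b c d. f c b a d) = sum_quads V f"
    by (rule reindex[of "\<lambda>(a, b, c, d). (c, b, a, d)" "\<lambda>(a, b, c, d). (c, b, a, d)"]) (auto simp: quads_def)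
qed

text \<open>For four distinct vertices and \<open>x\<close> the adjacency indicator, \<open>path_poly\<close> counts the 12 Hamiltonian
  paths. In \<open>bound_poly\<close> the coefficients 2, 2 and 1 of the numbers of perfect matchings, of complete
  graphs and of triangles are chosen so that the two agree on all complete multipartite graphs:
  12 = 6 + 2 + 4 on \<open>K\<^sub>4\<close>, 6 = 4 + 0 + 2 on \<open>K\<^sub>4\<close> minus an edge, 4 = 4 + 0 + 0 on the four-cycle.\<close>

definition path_poly :: "('a \<Rightarrow> 'a \<Rightarrow> int) \<Rightarrow> 'a \<Rightarrow> 'a \<Rightarrow> 'a \<Rightarrow> 'a \<Rightarrow> int" where
  "path_poly x a b c d =
   x a b * x b c * x c d +
   x a b * x b d * x d c +
   x a c * x c b * x b d +
   x a c * x c d * x d b +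
   x a d * x d b * x b c +
   x b c * x c d * x d a +
   x b a * x a c * x c d +
   x b a * x a d * x d c +
   x b c * x c a * x a d +
   x b d * x d a * x a c +
   x c a * x a b * x b d +
   x c b * x b a * x a d"

definition bound_poly :: "('a \<Rightarrow> 'a \<Rightarrow> int) \<Rightarrow> 'a \<Rightarrow> 'a \<Rightarrow> 'a \<Rightarrow> 'a \<Rightarrow> int" where
  "bound_poly x a b c d =
   2 * (x a b * x c d + x a c * x b d + x a d * x b c) +
   2 * (x a b * x a c * x a d * x b c * x b d * x c d) +
   (x a b * x b c * x a c + x a b * x b d * x a d + x a c * x c d * x a d + x b c * x c d * x b d)"

text \<open>In a simple graph on \<open>n\<close> vertices these four sums count each path 2 times,
  each pair of disjoint edges 8 times, each triangle \<open>6 * (n - 3)\<close> times and each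
  complete graph on four vertices 24 times.\<close>

definition path_sum :: "'a set set \<Rightarrow> 'a set \<Rightarrow> int" where
  "path_sum E V = sum_quads V (\<lambda>a b c d. adj E a b * adj E b c * adj E c d)"

definition matching_sum :: "'a set set \<Rightarrow> 'a set \<Rightarrow> int" where
  "matching_sum E V = sum_quads V (\<lambda>a b c d. adj E a b * adj E c d)"

definition triangle_sum :: "'a set set \<Rightarrow> 'a set \<Rightarrow> int" where
  "triangle_sum E V = sum_quads V (\<lambda>a b c d. adj E a b * adj E b c * adj E a c)"

definition K4_sum :: "'a set set \<Rightarrow> 'a set \<Rightarrow> int" where
  "K4_sum E V = sum_quads V (\<lambda>a b c d.
     adj E a b * adj E a c * adj E a d * adj E b c * adj E b d * adj E c d)"

section \<open>Comparison of the path count with the bound\<close>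

lemma sum_quads_add: "sum_quads V (\<lambda>a b c d. f a b c d + g a b c d) = sum_quads V f + sum_quads V g"
  by (simp add: sum_quads_def case_prod_unfold sum.distrib)

lemma sum_quads_cmult: "sum_quads V (\<lambda>a b c d. k * f a b c d) = k * sum_quads V f"
  by (simp add: sum_quads_def case_prod_unfold sum_distrib_left)

lemma sum_path_poly: "sum_quads V (path_poly (adj E)) = 12 * path_sum E V"
  unfolding path_poly_def sum_quads_add path_sum_def
  using sum_quads_permute[of V "\<lambda>a b c d. adj E a b * adj E b c * adj E c d"] by simp

text \<open>The coefficients are 2 times three perfect matchings, 2 times one complete graph, and
  four triangles.\<close>

lemma sum_bound_poly:
  "sum_quads V (bound_poly (adj E)) = 6 * matching_sum E V + 2 * K4_sum E V + 4 * triangle_sum E V"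
  unfolding bound_poly_def sum_quads_add sum_quads_cmult matching_sum_def triangle_sum_def K4_sum_def
  using sum_quads_permute(2,4)[of V "\<lambda>a b c d. adj E a b * adj E c d"]
    sum_quads_permute(1,3,5)[of V "\<lambda>a b c d. adj E a b * adj E b c * adj E a c"]
  by simp

text \<open>Once every pair is written in one order, only six 0/1 indicators remain and all cases
  can be checked.\<close>

lemma path_poly_le_bound_poly: "path_poly (adj E) a b c d \<le> bound_poly (adj E) a b c d"
  unfolding path_poly_def bound_poly_def
    adj_commute[of E b a] adj_commute[of E c a] adj_commute[of E d a]
    adj_commute[of E c b] adj_commute[of E d b] adj_commute[of E d c]
  unfolding adj_def of_bool_def by simp

text \<open>Here \<open>f\<close> names the class of a vertex: the four vertices induce a complete
  multipartite graph.\<close>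

lemma path_poly_eq_bound_poly:
  assumes "\<And>u v. u \<in> {a, b, c, d} \<Longrightarrow> v \<in> {a, b, c, d} \<Longrightarrow> adj E u v = of_bool (f u \<noteq> f v)"
  shows "path_poly (adj E) a b c d = bound_poly (adj E) a b c d"
  unfolding path_poly_def bound_poly_def by (auto simp: assms)

lemma path_sum_le: "12 * path_sum E V \<le> 6 * matching_sum E V + 2 * K4_sum E V + 4 * triangle_sum E V"
  unfolding sum_path_poly[symmetric] sum_bound_poly[symmetric] sum_quads_def
  by (auto intro!: sum_mono path_poly_le_bound_poly)

lemma path_sum_eq:
  assumes "\<And>u v. u \<in> V \<Longrightarrow> v \<in> V \<Longrightarrow> {u, v} \<in> E \<longleftrightarrow> f u \<noteq> f v"
  shows "12 * path_sum E V = 6 * matching_sum E V + 2 * K4_sum E V + 4 * triangle_sum E V"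
  unfolding sum_path_poly[symmetric] sum_bound_poly[symmetric] sum_quads_def
proof (intro sum.cong refl)
  fix q assume q: "q \<in> quads V"
  obtain a b c d where abcd: "q = (a, b, c, d)" by (cases q)
  have "adj E u v = of_bool (f u \<noteq> f v)" if "u \<in> {a, b, c, d}" "v \<in> {a, b, c, d}" for u v
  proof -
    have "u \<in> V" "v \<in> V" using that q abcd by (auto simp: quads_def)
    then show ?thesis by (simp add: adj_def assms)
  qed
  then have "path_poly (adj E) a b c d = bound_poly (adj E) a b c d"
    by (rule path_poly_eq_bound_poly)
  then show "(case q of (a, b, c, d) \<Rightarrow> path_poly (adj E) a b c d) =
      (case q of (a, b, c, d) \<Rightarrow> bound_poly (adj E) a b c d)"
    by (simp add: abcd)
qed

text \<open>Moving distinctness into the summand allows the variables to be summed out one at a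
  time.\<close>

lemma sum_quads_iterated:
  assumes "finite V"
  shows "sum_quads V f =
    (\<Sum>a\<in>V. \<Sum>b\<in>V. \<Sum>c\<in>V. \<Sum>d\<in>V. of_bool (distinct [a, b, c, d]) * f a b c d)"
proof -
  have "(\<Sum>a\<in>V. \<Sum>b\<in>V. \<Sum>c\<in>V. \<Sum>d\<in>V. of_bool (distinct [a, b, c, d]) * f a b c d)
    = (\<Sum>(a, b, c, d)\<in>V \<times> V \<times> V \<times> V. of_bool (distinct [a, b, c, d]) * f a b c d)"
    by (simp add: sum.cartesian_product)
  also have "\<dots> = sum_quads V f"
    unfolding sum_quads_def
  proof (rule sum.mono_neutral_cong_right[OF _ quads_subset])
    show "finite (V \<times> V \<times> V \<times> V)" using assms by simp
    show "\<forall>q\<in>V \<times> V \<times> V \<times> V - quads V.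
        (case q of (a, b, c, d) \<Rightarrow> of_bool (distinct [a, b, c, d]) * f a b c d) = 0"
      unfolding quads_def of_bool_def by auto
    show "(case q of (a, b, c, d) \<Rightarrow> of_bool (distinct [a, b, c, d]) * f a b c d) =
        (case q of (a, b, c, d) \<Rightarrow> f a b c d)" if "q \<in> quads V" for q
      using that unfolding quads_def of_bool_def by auto
  qed
  finally show ?thesis by simp
qed

section \<open>Clique counts as sums of adjacency products\<close>

lemma card_clique_lists:
  assumes "finite V"
  shows "card {xs. distinct xs \<and> set xs \<in> cliques E V s} = fact s * card (cliques E V s)"
proof -
  have "{xs. distinct xs \<and> set xs \<in> cliques E V s} = (\<Union>C\<in>cliques E V s. permutations_of_set C)"
    by (auto simp: permutations_of_set_def)
  also have "card \<dots> = (\<Sum>C\<in>cliques E V s. card (permutations_of_set C))"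
    using assms by (intro card_UN_disjoint) (auto dest: permutations_of_setD simp: cliques_def)
  also have "\<dots> = (\<Sum>C\<in>cliques E V s. fact s)"
    by (intro sum.cong refl) (simp add: cliquesD)
  finally show ?thesis by simp
qed

lemma simple_graph_edge:
  assumes "simple_graph (V, E)" "{a, b} \<in> E"
  shows "a \<noteq> b" "a \<in> V" "b \<in> V"
  using assms by (fastforce simp: simple_graph_def)+

text \<open>\<open>sorted_wrt\<close> demands adjacency of every pair of positions. Without loops
  this forces distinctness, and for a fixed length it unfolds to a finite conjunction.\<close>

lemma clique_lists_eq:
  assumes G: "simple_graph (V, E)"
  shows "{xs. distinct xs \<and> set xs \<in> cliques E V s} =
    {xs. set xs \<subseteq> V \<and> length xs = s \<and> sorted_wrt (\<lambda>a b. {a, b} \<in> E) xs}"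
proof -
  have "distinct xs \<and> (\<forall>u\<in>set xs. \<forall>v\<in>set xs. u \<noteq> v \<longrightarrow> {u, v} \<in> E) \<longleftrightarrow>
      sorted_wrt (\<lambda>a b. {a, b} \<in> E) xs" for xs
  proof (induction xs)
    case (Cons x xs)
    have "{x, v} \<in> E \<Longrightarrow> x \<noteq> v" for v using simple_graph_edge(1)[OF G] .
    with Cons show ?case by (auto simp: insert_commute)
  qed simp
  then have "distinct xs \<and> set xs \<in> cliques E V s \<longleftrightarrow>
      set xs \<subseteq> V \<and> length xs = s \<and> sorted_wrt (\<lambda>a b. {a, b} \<in> E) xs" for xs
    unfolding cliques_def using distinct_card[of xs] by auto
  then show ?thesis by simp
qed

lemma sum_edges:
  assumes G: "simple_graph (V, E)"
  shows "(\<Sum>a\<in>V. \<Sum>b\<in>V. adj E a b) = 2 * int (card (cliques E V 2))"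
proof -
  have fin: "finite V" using G by (simp add: simple_graph_def)
  let ?S = "{(a, b) \<in> V \<times> V. {a, b} \<in> E}"
  have "(\<Sum>a\<in>V. \<Sum>b\<in>V. adj E a b) = (\<Sum>(a, b)\<in>V \<times> V. of_bool ({a, b} \<in> E))"
    by (simp add: sum.cartesian_product adj_def)
  also have "\<dots> = int (card ?S)"
    using fin by (simp add: case_prod_unfold Int_def mem_Times_iff conj_assoc)
  also have "card ?S = card {xs. distinct xs \<and> set xs \<in> cliques E V 2}"
    unfolding clique_lists_eq[OF G]
    by (rule bij_betw_same_card[of "\<lambda>(a, b). [a, b]"],
        rule bij_betw_byWitness[where f' = "\<lambda>xs. (xs ! 0, xs ! 1)"])
      (auto simp: length_Suc_conv numeral_eq_Suc)
  finally show ?thesis by (simp add: card_clique_lists[OF fin])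
qed

lemma sum_triangles:
  assumes G: "simple_graph (V, E)"
  shows "(\<Sum>a\<in>V. \<Sum>b\<in>V. \<Sum>c\<in>V. adj E a b * adj E b c * adj E a c) = 6 * int (card (cliques E V 3))"
proof -
  have fin: "finite V" using G by (simp add: simple_graph_def)
  let ?S = "{(a, b, c) \<in> V \<times> V \<times> V. {a, b} \<in> E \<and> {b, c} \<in> E \<and> {a, c} \<in> E}"
  have "(\<Sum>a\<in>V. \<Sum>b\<in>V. \<Sum>c\<in>V. adj E a b * adj E b c * adj E a c)
    = (\<Sum>(a, b, c)\<in>V \<times> V \<times> V. of_bool ({a, b} \<in> E \<and> {b, c} \<in> E \<and> {a, c} \<in> E))"
    by (simp add: sum.cartesian_product adj_def of_bool_conj mult.assoc)
  also have "\<dots> = int (card ?S)"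
    using fin by (simp add: case_prod_unfold Int_def mem_Times_iff conj_assoc)
  also have "card ?S = card {xs. distinct xs \<and> set xs \<in> cliques E V 3}"
    unfolding clique_lists_eq[OF G]
    by (rule bij_betw_same_card[of "\<lambda>(a, b, c). [a, b, c]"],
        rule bij_betw_byWitness[where f' = "\<lambda>xs. (xs ! 0, xs ! 1, xs ! 2)"])
      (auto simp: length_Suc_conv numeral_eq_Suc)
  finally show ?thesis by (simp add: card_clique_lists[OF fin] fact_numeral)
qed

lemma K4_sum_eq:
  assumes G: "simple_graph (V, E)"
  shows "K4_sum E V = 24 * int (card (cliques E V 4))"
proof -
  have fin: "finite V" using G by (simp add: simple_graph_def)
  let ?P = "\<lambda>a b c d. {a, b} \<in> E \<and> {a, c} \<in> E \<and> {a, d} \<in> E \<and> {b, c} \<in> E \<and> {b, d} \<in> E \<and> {c, d} \<in> E"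
  let ?S = "{(a, b, c, d) \<in> quads V. ?P a b c d}"
  have "K4_sum E V = (\<Sum>(a, b, c, d)\<in>quads V. of_bool (?P a b c d))"
    unfolding K4_sum_def sum_quads_def by (intro sum.cong refl) (auto simp: adj_def)
  also have "\<dots> = int (card ?S)"
    using fin by (simp add: case_prod_unfold Int_def)
  \<comment> \<open>The six edges already force the vertices to be distinct.\<close>
  also have "?S = {(a, b, c, d). {a, b, c, d} \<subseteq> V \<and> ?P a b c d}"
    using simple_graph_edge(1)[OF G] by (auto simp: quads_def)
  also have "card \<dots> = card {xs. distinct xs \<and> set xs \<in> cliques E V 4}"
    unfolding clique_lists_eq[OF G]
    by (rule bij_betw_same_card[of "\<lambda>(a, b, c, d). [a, b, c, d]"],
        rule bij_betw_byWitness[where f' = "\<lambda>xs. (xs ! 0, xs ! 1, xs ! 2, xs ! 3)"])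
      (auto simp: length_Suc_conv numeral_eq_Suc)
  finally show ?thesis by (simp add: card_clique_lists[OF fin] fact_numeral)
qed

lemma triangle_sum_eq:
  assumes G: "simple_graph (V, E)"
  shows "triangle_sum E V = (int (card V) - 3) * (6 * int (card (cliques E V 3)))"
proof -
  have fin: "finite V" using G by (simp add: simple_graph_def)
  have "(\<Sum>d\<in>V. of_bool (distinct [a, b, c, d]) * (adj E a b * adj E b c * adj E a c))
      = (int (card V) - 3) * (adj E a b * adj E b c * adj E a c)" if V: "a \<in> V" "b \<in> V" "c \<in> V" for a b c
  proof (cases "{a, b} \<in> E \<and> {b, c} \<in> E \<and> {a, c} \<in> E")
    case True
    then have ne: "a \<noteq> b" "b \<noteq> c" "a \<noteq> c" using simple_graph_edge(1)[OF G] by blast+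
    have "(\<Sum>d\<in>V. of_bool (distinct [a, b, c, d])) = int (card {d \<in> V. distinct [a, b, c, d]})"
      using fin by (simp add: Int_def conj_commute)
    also have "{d \<in> V. distinct [a, b, c, d]} = V - {a, b, c}" using ne by auto
    \<comment> \<open>The triangle lies in \<open>V\<close>, so \<open>card V\<close> is at least 3
      and the natural subtraction is not truncated.\<close>
    also have "int (card \<dots>) = int (card V) - 3"
    proof -
      have "card {a, b, c} = 3" using ne by simp
      moreover have "card {a, b, c} \<le> card V" using V fin by (intro card_mono) auto
      ultimately show ?thesis using V by (subst card_Diff_subset) auto
    qed
    finally show ?thesis by (simp add: sum_distrib_right[symmetric])
  qed (auto simp: adj_def)
  then have "triangle_sum E V =
      (\<Sum>a\<in>V. \<Sum>b\<in>V. \<Sum>c\<in>V. (int (card V) - 3) * (adj E a b * adj E b c * adj E a c))"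
    unfolding triangle_sum_def sum_quads_iterated[OF fin] by (intro sum.cong refl)
  then show ?thesis by (simp add: sum_distrib_left[symmetric] sum_triangles[OF G])
qed

section \<open>Pairs of disjoint edges in terms of degrees\<close>

definition deg :: "'a set set \<Rightarrow> 'a set \<Rightarrow> 'a \<Rightarrow> int" where
  "deg E V a = (\<Sum>b\<in>V. adj E a b)"

text \<open>Inclusion-exclusion over pairs of oriented edges. Each of the four possible coincidences
  of endpoints removes the sum of squared degrees; the two ways in which both edges coincide were
  removed twice, and each gives back the degree sum.\<close>

lemma matching_sum_eq:
  assumes G: "simple_graph (V, E)"
  shows "matching_sum E V = (\<Sum>a\<in>V. deg E V a)\<^sup>2 + 2 * (\<Sum>a\<in>V. deg E V a) - 4 * (\<Sum>a\<in>V. (deg E V a)\<^sup>2)"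
proof -
  have fin: "finite V" using G by (simp add: simple_graph_def)
  \<comment> \<open>The coincidences are written as nested conditionals so that the sums over
    \<open>c\<close> and \<open>d\<close> collapse to single terms.\<close>
  have split: "of_bool (distinct [a, b, c, d]) * (adj E a b * adj E c d) =
      adj E a b * adj E c d
      - (if c = a then adj E a b * adj E c d else 0) - (if c = b then adj E a b * adj E c d else 0)
      - (if d = a then adj E a b * adj E c d else 0) - (if d = b then adj E a b * adj E c d else 0)
      + (if c = a then if d = b then adj E a b * adj E c d else 0 else 0)
      + (if c = b then if d = a then adj E a b * adj E c d else 0 else 0)" for a b c d
  proof (cases "adj E a b * adj E c d = 0")
    case True
    then show ?thesis by (simp only: mult_zero_right if_cancel)
  next
    case False
    then have "a \<noteq> b" "c \<noteq> d"
      using simple_graph_edge(1)[OF G] by (auto simp: adj_def)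
    then show ?thesis
      by (cases "c = a"; cases "c = b"; cases "d = a"; cases "d = b"; simp)
  qed
  have inner: "(\<Sum>c\<in>V. \<Sum>d\<in>V. of_bool (distinct [a, b, c, d]) * (adj E a b * adj E c d)) =
      adj E a b * (\<Sum>v\<in>V. deg E V v) - 2 * (adj E a b * deg E V a) - 2 * (adj E a b * deg E V b) + 2 * adj E a b"
    if V: "a \<in> V" "b \<in> V" for a b
  proof -
    have [simp]: "(\<Sum>d\<in>V. if P then f d else 0) = (if P then (\<Sum>d\<in>V. f d) else 0)" for P and f :: "'a \<Rightarrow> int"
      by simp
    have c: "(\<Sum>c\<in>V. adj E c v) = deg E V v" for v
      unfolding deg_def by (simp add: adj_commute)
    have sq: "adj E a b * adj E a b = adj E a b" "adj E a b * adj E b a = adj E a b"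
      by (auto simp: adj_def insert_commute)
    show ?thesis
      unfolding split sum.distrib sum_subtractf using fin V
      by (simp add: sum_distrib_left[symmetric] c sq deg_def[symmetric])
  qed
  have a: "(\<Sum>b\<in>V. adj E a b * k) = deg E V a * k" for a k
    by (simp add: deg_def sum_distrib_right)
  have b: "(\<Sum>a\<in>V. \<Sum>b\<in>V. adj E a b * deg E V b) = (\<Sum>b\<in>V. (deg E V b)\<^sup>2)"
    by (subst sum.swap) (simp add: adj_commute[of E _ ] sum_distrib_right[symmetric] deg_def power2_eq_square)
  have "matching_sum E V = (\<Sum>a\<in>V. \<Sum>b\<in>V. adj E a b * (\<Sum>v\<in>V. deg E V v)
      - 2 * (adj E a b * deg E V a) - 2 * (adj E a b * deg E V b) + 2 * adj E a b)"
    unfolding matching_sum_def sum_quads_iterated[OF fin] by (intro sum.cong refl inner)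
  also have "\<dots> = (\<Sum>a\<in>V. deg E V a)\<^sup>2 - 2 * (\<Sum>a\<in>V. (deg E V a)\<^sup>2) - 2 * (\<Sum>a\<in>V. (deg E V a)\<^sup>2)
      + 2 * (\<Sum>a\<in>V. deg E V a)"
    by (simp add: sum.distrib sum_subtractf sum_distrib_left[symmetric] a b)
      (simp add: deg_def[symmetric] power2_eq_square sum_distrib_right)
  finally show ?thesis by simp
qed

section \<open>Paths on four vertices\<close>

text \<open>The middle edge is the only one that meets both others, so the edge set determines the
  path up to reversal.\<close>

lemma path_edge_sets_eq:
  assumes "distinct [a, b, c, d]" "distinct [a', b', c', d']"
    and eq: "{{a, b}, {b, c}, {c, d}} = {{a', b'}, {b', c'}, {c', d'}}"
  shows "(a', b', c', d') = (a, b, c, d) \<or> (a', b', c', d') = (d, c, b, a)"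
proof -
  have mid: "{b', c'} \<in> {{a, b}, {b, c}, {c, d}}" "{a', b'} \<in> {{a, b}, {b, c}, {c, d}}"
    "{c', d'} \<in> {{a, b}, {b, c}, {c, d}}" using eq by auto
  have meet: "e \<inter> {b', c'} \<noteq> {}" if "e \<in> {{a, b}, {b, c}, {c, d}}" for e
    using that unfolding eq by auto
  have "{b', c'} \<noteq> {a, b}" using meet[of "{c, d}"] assms(1) by auto
  moreover have "{b', c'} \<noteq> {c, d}" using meet[of "{a, b}"] assms(1) by auto
  ultimately have "{b', c'} = {b, c}" using mid(1) by blast
  then consider "b' = b" "c' = c" | "b' = c" "c' = b" by (auto simp: doubleton_eq_iff)
  then show ?thesis
    using mid(2,3) assms(1,2) by cases (auto simp: doubleton_eq_iff)
qed

lemma path_graph_4_eq: "path_graph 4 = ({..<4}, {{0, 1}, {1, 2}, {2, 3}})"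
proof -
  have "{{i, Suc i} |i. Suc i < 4} = (\<lambda>i. {i, Suc i}) ` {..<3}" by auto
  also have "{..<3} = {0, 1, 2 :: nat}" by auto
  finally show ?thesis by (simp add: path_graph_def numeral_eq_Suc)
qed

lemma lessThan_4: "{..<4 :: nat} = {0, 1, 2, 3}"
  by auto

lemma copies_path_graph_4:
  assumes G: "simple_graph (V, E)"
  shows "copies (path_graph 4) (V, E) =
    (\<lambda>(a, b, c, d). ({a, b, c, d}, {{a, b}, {b, c}, {c, d}})) `
      {(a, b, c, d) \<in> quads V. {a, b} \<in> E \<and> {b, c} \<in> E \<and> {c, d} \<in> E}"
    (is "_ = ?F ` ?Q")
proof (intro equalityI subsetI)
  fix S assume S: "S \<in> copies (path_graph 4) (V, E)"
  obtain W D where WD: "S = (W, D)" by (cases S)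
  have sub: "simple_graph (W, D)" "W \<subseteq> V" "D \<subseteq> E"
    using S by (auto simp: copies_def subgraph_def WD)
  obtain f :: "nat \<Rightarrow> 'a" where f: "bij_betw f {..<4} W"
    "\<And>u v. u < 4 \<Longrightarrow> v < 4 \<Longrightarrow> {u, v} \<in> {{0, 1}, {1, 2}, {2, 3}} \<longleftrightarrow> {f u, f v} \<in> D"
  proof -
    from S have "graph_iso (path_graph 4) (W, D)" by (simp add: copies_def WD)
    then show thesis unfolding graph_iso_def path_graph_4_eq fst_conv snd_conv
      using that by (metis lessThan_iff)
  qed
  have W: "W = {f 0, f 1, f 2, f 3}" using bij_betw_imp_surj_on[OF f(1)] by (simp add: lessThan_4)
  have dist: "distinct [f 0, f 1, f 2, f 3]"
    using bij_betw_imp_inj_on[OF f(1)] by (auto simp: inj_on_def lessThan_4)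
  have in_D: "{f 0, f 1} \<in> D" "{f 1, f 2} \<in> D" "{f 2, f 3} \<in> D"
    using f(2)[of 0 1] f(2)[of 1 2] f(2)[of 2 3] by auto
  \<comment> \<open>Every edge of the copy joins two vertices of \<open>W\<close>, so it pulls back
    along \<open>f\<close> to an edge of the path.\<close>
  have "D \<subseteq> {{f 0, f 1}, {f 1, f 2}, {f 2, f 3}}"
  proof
    fix e assume e: "e \<in> D"
    then have "e \<subseteq> W" "card e = 2" using sub(1) by (auto simp: simple_graph_def)
    then obtain x y where xy: "e = {x, y}" "x \<in> W" "y \<in> W" by (auto simp: card_2_iff)
    then obtain u v where uv: "u < 4" "v < 4" "x = f u" "y = f v"
      using bij_betw_imp_surj_on[OF f(1)] by auto
    then have "{u, v} \<in> {{0, 1}, {1, 2}, {2, 3}}" using f(2)[OF uv(1,2)] e xy(1) uv(3,4) by simp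
    then have "f ` {u, v} \<in> image f ` {{0, 1}, {1, 2}, {2, 3}}" by (rule imageI)
    then show "e \<in> {{f 0, f 1}, {f 1, f 2}, {f 2, f 3}}" using xy uv by simp
  qed
  with in_D have "D = {{f 0, f 1}, {f 1, f 2}, {f 2, f 3}}" by blast
  then have "S = ?F (f 0, f 1, f 2, f 3)" by (simp add: WD W)
  moreover have "(f 0, f 1, f 2, f 3) \<in> ?Q"
    using dist W sub(2,3) in_D by (auto simp: quads_def)
  ultimately show "S \<in> ?F ` ?Q" by (rule image_eqI)
next
  fix S assume "S \<in> ?F ` ?Q"
  then obtain a b c d where S: "S = ({a, b, c, d}, {{a, b}, {b, c}, {c, d}})"
    and q: "{a, b, c, d} \<subseteq> V" "distinct [a, b, c, d]" "{a, b} \<in> E" "{b, c} \<in> E" "{c, d} \<in> E"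
    by (auto simp: quads_def)
  have "subgraph S (V, E)" using q by (auto simp: S subgraph_def simple_graph_def)
  moreover have "graph_iso (path_graph 4) S"
    unfolding graph_iso_def
  proof (intro exI conjI)
    let ?f = "\<lambda>i. [a, b, c, d] ! i"
    show "bij_betw ?f (verts (path_graph 4)) (verts S)"
      using q(2) bij_betw_nth[of "[a, b, c, d]" "{..<4}"] by (simp add: S path_graph_4_eq)
    show "\<forall>u\<in>verts (path_graph 4). \<forall>v\<in>verts (path_graph 4).
        {u, v} \<in> edges (path_graph 4) \<longleftrightarrow> {?f u, ?f v} \<in> edges S"
      using q(2) unfolding S path_graph_4_eq fst_conv snd_conv lessThan_4
      by (simp add: doubleton_eq_iff) auto
  qed
  ultimately show "S \<in> copies (path_graph 4) (V, E)" by (simp add: copies_def)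
qed

text \<open>The map from quadruples to copies is two-to-one: each fibre is a quadruple and its
  reversal.\<close>

lemma num_copies_path_graph_4:
  assumes G: "simple_graph (V, E)"
  shows "path_sum E V = 2 * int (num_copies (path_graph 4) (V, E))"
proof -
  have fin: "finite V" using G by (simp add: simple_graph_def)
  define F where "F = (\<lambda>(a :: 'a, b, c, d). ({a, b, c, d}, {{a, b}, {b, c}, {c, d}}))"
  define Q where "Q = {(a, b, c, d) \<in> quads V. {a, b} \<in> E \<and> {b, c} \<in> E \<and> {c, d} \<in> E}"
  have copies: "copies (path_graph 4) (V, E) = F ` Q"
    unfolding F_def Q_def by (rule copies_path_graph_4[OF G])
  have finQ: "finite Q" by (rule finite_subset[OF _ finite_quads[OF fin]]) (auto simp: Q_def)
  have "card {q \<in> Q. F q = S} = 2" if S: "S \<in> F ` Q" for S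
  proof -
    obtain a b c d where q: "(a, b, c, d) \<in> Q" "S = F (a, b, c, d)"
      using S by auto
    then have dist: "distinct [a, b, c, d]" by (auto simp: Q_def quads_def)
    have "{q \<in> Q. F q = S} = {(a, b, c, d), (d, c, b, a)}"
    proof (intro equalityI subsetI)
      fix p assume p: "p \<in> {q \<in> Q. F q = S}"
      obtain a' b' c' d' where p': "p = (a', b', c', d')" by (cases p)
      have "distinct [a', b', c', d']" using p p' by (auto simp: Q_def quads_def)
      moreover have "{{a, b}, {b, c}, {c, d}} = {{a', b'}, {b', c'}, {c', d'}}"
        using p p' q(2) by (simp add: F_def)
      ultimately have "p = (a, b, c, d) \<or> p = (d, c, b, a)"
        unfolding p' by (rule path_edge_sets_eq[OF dist])
      then show "p \<in> {(a, b, c, d), (d, c, b, a)}" by simp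
    next
      fix p assume "p \<in> {(a, b, c, d), (d, c, b, a)}"
      then show "p \<in> {q \<in> Q. F q = S}"
        using q by (auto simp: Q_def quads_def F_def insert_commute)
    qed
    then show ?thesis using dist by simp
  qed
  moreover have "card Q = (\<Sum>S\<in>F ` Q. card {q \<in> Q. F q = S})"
    using sum.image_gen[OF finQ, of "\<lambda>_. 1 :: nat" F] by simp
  ultimately have "card Q = 2 * card (F ` Q)" by simp
  moreover have "path_sum E V = int (card Q)"
  proof -
    have "path_sum E V = (\<Sum>(a, b, c, d)\<in>quads V. of_bool ({a, b} \<in> E \<and> {b, c} \<in> E \<and> {c, d} \<in> E))"
      unfolding path_sum_def sum_quads_def by (intro sum.cong refl) (auto simp: adj_def)
    then show ?thesis using fin by (simp add: case_prod_unfold Int_def Q_def)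
  qed
  ultimately show ?thesis by (simp add: num_copies_def copies)
qed

section \<open>Freeness from complete graphs in terms of cliques\<close>

lemma graph_free_complete_graph_iff:
  assumes G: "simple_graph (V, E)"
  shows "graph_free (complete_graph k) (V, E) \<longleftrightarrow> cliques E V k = {}"
proof -
  have "cliques E V k \<noteq> {}" if S: "(W, D) \<in> copies (complete_graph k) (V, E)" for W D
  proof -
    have sub: "W \<subseteq> V" "D \<subseteq> E" using S by (auto simp: copies_def subgraph_def)
    obtain f where f: "bij_betw f {..<k} W"
      "\<And>u v. u < k \<Longrightarrow> v < k \<Longrightarrow> {u, v} \<subseteq> {..<k} \<and> card {u, v} = 2 \<longleftrightarrow> {f u, f v} \<in> D"
      using S by (auto simp: copies_def graph_iso_def complete_graph_def)
    have "{x, y} \<in> E" if xy: "x \<in> W" "y \<in> W" "x \<noteq> y" for x y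
    proof -
      obtain u v where uv: "u < k" "v < k" "x = f u" "y = f v"
        using xy bij_betw_imp_surj_on[OF f(1)] by auto
      then have "u \<noteq> v" using xy by auto
      then show ?thesis using uv f(2)[of u v] sub by auto
    qed
    moreover have "finite W" "card W = k"
      using f(1) bij_betw_finite bij_betw_same_card by fastforce+
    ultimately have "W \<in> cliques E V k" using sub by (intro cliquesI) auto
    then show ?thesis by blast
  qed
  moreover have "copies (complete_graph k) (V, E) \<noteq> {}" if C: "C \<in> cliques E V k" for C
  proof -
    note CD = cliquesD[OF C]
    let ?S = "(C, {e. e \<subseteq> C \<and> card e = 2})"
    have "subgraph ?S (V, E)"
      using CD by (auto simp: subgraph_def simple_graph_def card_2_iff)
    moreover obtain f where f: "bij_betw f {..<k} C"
      using CD(2,3) ex_bij_betw_nat_finite by (metis atLeast0LessThan)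
    have "graph_iso (complete_graph k) ?S"
      unfolding graph_iso_def
    proof (intro exI conjI)
      show "bij_betw f (verts (complete_graph k)) (verts ?S)"
        using f by (simp add: complete_graph_def)
      show "\<forall>u\<in>verts (complete_graph k). \<forall>v\<in>verts (complete_graph k).
          {u, v} \<in> edges (complete_graph k) \<longleftrightarrow> {f u, f v} \<in> edges ?S"
      proof (intro ballI)
        fix u v assume "u \<in> verts (complete_graph k)" "v \<in> verts (complete_graph k)"
        then have uv: "u < k" "v < k" by (simp_all add: complete_graph_def)
        then have "f u \<in> C" "f v \<in> C" "f u = f v \<longleftrightarrow> u = v"
          using f by (auto simp: bij_betw_def inj_on_eq_iff)
        moreover have "card {x, y} = 2 \<longleftrightarrow> x \<noteq> y" for x y :: 'a
          by (cases "x = y") auto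
        moreover have "card {x, y} = 2 \<longleftrightarrow> x \<noteq> y" for x y :: nat
          by (cases "x = y") auto
        ultimately show "{u, v} \<in> edges (complete_graph k) \<longleftrightarrow> {f u, f v} \<in> edges ?S"
          using uv by (simp add: complete_graph_def)
      qed
    qed
    ultimately show ?thesis by (auto simp: copies_def)
  qed
  ultimately show ?thesis unfolding graph_free_def by (metis all_not_in_conv surj_pair)
qed

section \<open>Degrees of the Turan graph and the final comparison\<close>

lemma simple_turan_graph: "simple_graph (turan_graph r n)"
  by (auto simp: simple_graph_def turan_graph_def card_2_iff)

lemma turan_graph_eq: "turan_graph r n = ({..<n}, edges (turan_graph r n))"
  by (simp add: turan_graph_def)

lemma turan_graph_degrees:
  assumes "n \<ge> 10" "r \<ge> 2"
  obtains q where "q \<ge> 1"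
    "\<And>v. v < n \<Longrightarrow> deg (edges (turan_graph r n)) {..<n} v \<in> {q, q + 1}"
proof -
  define c where "c = n div r"
  have c2: "2 * c \<le> n"
  proof -
    have "2 * c \<le> r * c" using assms(2) by simp
    also have "r * c \<le> n" by (simp add: c_def)
    finally show ?thesis .
  qed
  \<comment> \<open>Classes have \<open>c\<close> or \<open>c + 1\<close> vertices, so degrees are
    \<open>n - c\<close> or \<open>n - c - 1\<close>. As \<open>r \<ge> 2\<close> gives
    \<open>2 * c \<le> n\<close>, the smaller one is at least 1 for
    \<open>n \<ge> 10\<close>.\<close>
  show thesis
  proof (rule that[of "int n - int c - 1"])
    show "int n - int c - 1 \<ge> 1" using c2 assms(1) by linarith
    fix v assume v: "v < n"
    let ?C = "{w \<in> {..<n}. w mod r = v mod r}"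
    have "\<lfloor>real n / real r\<rfloor> = int c" by (simp add: c_def floor_divide_of_nat_eq)
    moreover have "\<lceil>real n / real r\<rceil> \<le> \<lfloor>real n / real r\<rfloor> + 1" by linarith
    moreover have "\<lfloor>real n / real r\<rfloor> \<le> \<lceil>real n / real r\<rceil>" by linarith
    ultimately have "card ?C = c \<or> card ?C = c + 1"
      using turan_graph_class_size[of "v mod r" r n] assms(2) by (auto simp: turan_graph_def)
    moreover have "deg (edges (turan_graph r n)) {..<n} v = int n - int (card ?C)"
    proof -
      have "deg (edges (turan_graph r n)) {..<n} v = (\<Sum>w<n. of_bool (w mod r \<noteq> v mod r))"
        unfolding deg_def adj_def by (intro sum.cong refl) (auto simp: edges_turan_graph_iff v)
      also have "\<dots> = int (card ({..<n} - ?C))"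
        by (simp add: Int_def) (intro arg_cong[of _ _ card], auto)
      also have "\<dots> = int n - int (card ?C)"
      proof -
        have "?C \<subseteq> {..<n}" by blast
        then have "card ?C \<le> n" "card ({..<n} - ?C) = n - card ?C"
          using card_mono[of "{..<n}" ?C] by (simp_all add: card_Diff_subset finite_subset)
        then show ?thesis by simp
      qed
      finally show ?thesis .
    qed
    ultimately show "deg (edges (turan_graph r n)) {..<n} v \<in> {int n - int c - 1, int n - int c - 1 + 1}"
      by auto
  qed
qed

lemma sum_deg:
  assumes "simple_graph (V, E)"
  shows "(\<Sum>a\<in>V. deg E V a) = 2 * int (card (cliques E V 2))"
  unfolding deg_def by (rule sum_edges[OF assms])

text \<open>For integers \<open>d\<close> and \<open>q\<close> one has \<open>(d - q) * (d - q - 1) \<ge> 0\<close>, with equality if \<open>d\<close> is \<open>q\<close> or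
  \<open>q + 1\<close>; summing over the degrees, this bounds the sum of their squares below by a linear function
  of the number of edges, sharply for the Turan graph.\<close>

lemma matching_sum_le_turan:
  assumes G: "simple_graph (V, E)" and n: "card V = n" "n \<ge> 10" and r: "r \<ge> 2"
    and free: "cliques E V (Suc r) = {}"
  shows "matching_sum E V \<le> matching_sum (edges (turan_graph r n)) {..<n}"
proof -
  let ?T = "edges (turan_graph r n)"
  obtain q where q: "q \<ge> 1" "\<And>v. v < n \<Longrightarrow> deg ?T {..<n} v \<in> {q, q + 1}"
    using turan_graph_degrees[OF n(2) r] by blast
  have T: "simple_graph ({..<n}, ?T)" using simple_turan_graph turan_graph_eq by metis
  have fin: "finite V" using G by (simp add: simple_graph_def)
  define m m' where "m = (\<Sum>v\<in>V. deg E V v)" and "m' = (\<Sum>v<n. deg ?T {..<n} v)"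
  have expand: "(\<Sum>v\<in>A. (f v - q) * (f v - q - 1)) =
      (\<Sum>v\<in>A. (f v)\<^sup>2) - (2 * q + 1) * (\<Sum>v\<in>A. f v) + int (card A) * (q * (q + 1))"
    for A :: "'b set" and f
  proof -
    have "(\<Sum>v\<in>A. (f v - q) * (f v - q - 1)) = (\<Sum>v\<in>A. (f v)\<^sup>2 - (2 * q + 1) * f v + q * (q + 1))"
      by (intro sum.cong refl) (simp add: algebra_simps power2_eq_square)
    then show ?thesis by (simp add: sum.distrib sum_subtractf sum_distrib_left)
  qed
  have "(d - q) * (d - q - 1) \<ge> 0" for d :: int
    by (cases "d \<le> q") (auto intro: mult_nonpos_nonpos)
  then have "(\<Sum>v\<in>V. (deg E V v - q) * (deg E V v - q - 1)) \<ge> 0" by (simp add: sum_nonneg)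
  then have sq: "(\<Sum>v\<in>V. (deg E V v)\<^sup>2) \<ge> (2 * q + 1) * m - int n * (q * (q + 1))"
    unfolding expand m_def by (simp add: n(1))
  have "(\<Sum>v<n. (deg ?T {..<n} v - q) * (deg ?T {..<n} v - q - 1)) = 0"
    using q(2) by (intro sum.neutral) fastforce
  then have sq': "(\<Sum>v<n. (deg ?T {..<n} v)\<^sup>2) = (2 * q + 1) * m' - int n * (q * (q + 1))"
    unfolding expand m'_def by simp
  have "card (cliques E V 2) \<le> card (cliques ?T {..<n} 2)"
    using card_cliques_le_turan[OF _ fin free] r n(1) by auto
  then have mm: "m \<le> m'" unfolding m_def m'_def sum_deg[OF G] sum_deg[OF T] by simp
  have m0: "m \<ge> 0" unfolding m_def deg_def adj_def by (intro sum_nonneg) auto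
  \<comment> \<open>By \<open>sq\<close>, the matching sum is at most
    \<open>m * m - (8 * q + 2) * m\<close> plus a constant shared with the Turan graph, where
    equality holds by \<open>sq'\<close>. Replacing \<open>m\<close> by \<open>m'\<close> does not
    lower this once \<open>m'\<close> is at least \<open>8 * q + 2\<close>; the minimum degree bound
    and \<open>n \<ge> 10\<close> give \<open>m' \<ge> 10 * q\<close>.\<close>
  have "(\<Sum>v<n. q) \<le> m'" unfolding m'_def using q(2) by (intro sum_mono) force
  moreover have "10 * q \<le> int n * q" using n(2) q(1) by (intro mult_right_mono) auto
  moreover have "(\<Sum>v<n. q) = int n * q" by simp
  ultimately have "8 * q + 2 \<le> m'" using q(1) by linarith
  then have "0 \<le> (m' - m) * (m' + m - 8 * q - 2)" using mm m0 by (intro mult_nonneg_nonneg) auto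
  then have "m\<^sup>2 - (8 * q + 2) * m \<le> m'\<^sup>2 - (8 * q + 2) * m'"
    by (simp add: algebra_simps power2_eq_square)
  then show ?thesis
    unfolding matching_sum_eq[OF G] matching_sum_eq[OF T] m_def[symmetric] m'_def[symmetric] sq'
    using sq by (simp add: algebra_simps)
qed

lemma num_copies_path_le_turan:
  assumes G: "simple_graph (V, E)" and n: "card V = n" "n \<ge> 10" and r: "r \<ge> 2"
    and free: "cliques E V (Suc r) = {}"
  shows "num_copies (path_graph 4) (V, E) \<le> num_copies (path_graph 4) (turan_graph r n)"
proof -
  let ?T = "edges (turan_graph r n)"
  have T: "simple_graph ({..<n}, ?T)" using simple_turan_graph turan_graph_eq by metis
  have fin: "finite V" using G by (simp add: simple_graph_def)
  have cl: "card (cliques E V s) \<le> card (cliques ?T {..<n} s)" for s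
    using card_cliques_le_turan[OF _ fin free] r n(1) by auto
  have "K4_sum E V \<le> K4_sum ?T {..<n}"
    unfolding K4_sum_eq[OF G] K4_sum_eq[OF T] using cl by simp
  \<comment> \<open>The common factor \<open>n - 3\<close> is nonnegative because
    \<open>n \<ge> 10\<close>.\<close>
  moreover have "triangle_sum E V \<le> triangle_sum ?T {..<n}"
    unfolding triangle_sum_eq[OF G] triangle_sum_eq[OF T] using cl n by (intro mult_mono) auto
  moreover have "matching_sum E V \<le> matching_sum ?T {..<n}"
    by (rule matching_sum_le_turan[OF assms])
  moreover have "12 * path_sum ?T {..<n} =
      6 * matching_sum ?T {..<n} + 2 * K4_sum ?T {..<n} + 4 * triangle_sum ?T {..<n}"
    by (rule path_sum_eq[where f = "\<lambda>v. v mod r"]) (simp add: edges_turan_graph_iff)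
  ultimately have "path_sum E V \<le> path_sum ?T {..<n}"
    using path_sum_le[of E V] by linarith
  then show ?thesis
    unfolding num_copies_path_graph_4[OF G] num_copies_path_graph_4[OF T]
    by (simp add: turan_graph_eq[symmetric])
qed

theorem theorem3p1:
  fixes k :: nat
  assumes "k \<ge> 5"
  shows "turan_good k (path_graph 4)"
proof -
  have path: "simple_graph (path_graph 4)"
    by (simp add: simple_graph_def path_graph_4_eq)
  \<comment> \<open>The path has only four vertices, fewer than \<open>k\<close>.\<close>
  have "cliques (edges (path_graph 4)) {..<4} k = {}"
  proof (rule ccontr)
    assume "\<not> ?thesis"
    then obtain C where "C \<in> cliques (edges (path_graph 4)) {..<4} k" by blast
    from cliquesD[OF this] have "k \<le> card {..<4 :: nat}" by (metis card_mono finite_lessThan)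
    with assms show False by simp
  qed
  then have free: "graph_free (complete_graph k) (path_graph 4)"
    using graph_free_complete_graph_iff[of "{..<4}" "edges (path_graph 4)" k] path
    by (simp add: path_graph_4_eq)
  \<comment> \<open>The threshold 10 comes from the matching comparison. The Turan graph is itself a
    competitor, so the upper bound is attained.\<close>
  have "gen_turan_number n (path_graph 4) (complete_graph k) =
      num_copies (path_graph 4) (turan_graph (k - 1) n)" if n: "n \<ge> 10" for n
    unfolding gen_turan_number_def
  proof (rule Max_eqI[OF finite_num_copies])
    fix y assume "y \<in> {num_copies (path_graph 4) G |G :: nat graph.
        simple_graph G \<and> card (verts G) = n \<and> graph_free (complete_graph k) G}"
    then obtain V :: "nat set" and E where y: "y = num_copies (path_graph 4) (V, E)"
      and G: "simple_graph (V, E)" "card V = n" "graph_free (complete_graph k) (V, E)" by auto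
    have "cliques E V (Suc (k - 1)) = {}"
      using G(3) graph_free_complete_graph_iff[OF G(1)] assms by simp
    then show "y \<le> num_copies (path_graph 4) (turan_graph (k - 1) n)"
      unfolding y using num_copies_path_le_turan[OF G(1,2) n] assms by simp
  next
    let ?T = "turan_graph (k - 1) n"
    have "cliques (edges ?T) {..<n} k = {}"
      using turan_graph_clique_free[of "k - 1" n] assms by simp
    then have "graph_free (complete_graph k) ?T"
      using graph_free_complete_graph_iff simple_turan_graph turan_graph_eq by metis
    moreover have "card (verts ?T) = n" by (simp add: turan_graph_def)
    ultimately show "num_copies (path_graph 4) ?T \<in> {num_copies (path_graph 4) G |G :: nat graph.
        simple_graph G \<and> card (verts G) = n \<and> graph_free (complete_graph k) G}"
      using simple_turan_graph by blast
  qed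
  with path free show ?thesis unfolding turan_good_def by blast
qed

end
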